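(* Let $G=\langle \mathcal X\mid\mathcal Q\mid\Phi\mid\mathcal R\rangle$ be a group given by an invariant finite $L$-presentation. Let $\mathcal U\unlhd G$ be a normal subgroup of finite index which is $\Phi$-invariant, i.e. each endomorphism of $G$ induced by an element of $\Phi$ maps $\mathcal U$ into $\mathcal U$. Then $\mathcal U$ is invariantly finitely $L$-presented.
   Context: A finite $L$-presentation $\langle \mathcal X\mid\mathcal Q\mid\Phi\mid\mathcal R\rangle$ consists of a finite alphabet $\mathcal X$, finite subsets $\mathcal Q,\mathcal R$ of the free group $F$ over $\mathcal X$, and a finite set $\Phi$ of endomorphisms of $F$. Let $\Phi^*$ denote the monoid of endomorphisms of $F$ generated by $\Phi$ (including the identity). The $L$-presentation defines the group $F/K$, where $K$ is the normal closure in $F$ of $\mathcal Q\cup\bigcup_{\sigma\in\Phi^*}\mathcal R^\sigma$. The finite $L$-presentation is invariant if $K^\varphi\subseteq K$ for every $\varphi\in\Phi$ (so that each $\varphi\in\Phi$ induces an endomorphism of $F/K$). A group is invariantly finitely $L$-presented if it is isomorphic to a group defined by some invariant finite $L$-presentation. *)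

theory Defs
  imports "HOL-Algebra.Coset"
begin

section \<open>Free groups\<close>

text \<open>
  The letter \<open>(x, True)\<close> stands for the generator \<open>x\<close> and \<open>(x, False)\<close> for its inverse.
  The elements of the free group are the reduced words; \<open>red_cons\<close> multiplies a reduced word
  by a letter on the left, cancelling if necessary.
\<close>

type_synonym 'a letter = "'a \<times> bool"

definition inv_letter :: "'a letter \<Rightarrow> 'a letter"
  where "inv_letter l = (fst l, \<not> snd l)"

definition reduced :: "'a letter list \<Rightarrow> bool"
  where "reduced w \<longleftrightarrow> successively (\<lambda>k l. l \<noteq> inv_letter k) w"

definition red_cons :: "'a letter \<Rightarrow> 'a letter list \<Rightarrow> 'a letter list"
  where "red_cons l w = (if w \<noteq> [] \<and> hd w = inv_letter l then tl w else l # w)"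

definition free_group :: "'a set \<Rightarrow> 'a letter list monoid"
  where "free_group A =
    \<lparr>carrier = {w \<in> lists (A \<times> UNIV). reduced w},
     monoid.mult = (\<lambda>u v. foldr red_cons u v),
     one = []\<rparr>"

definition free_gen :: "'a \<Rightarrow> 'a letter list"
  where "free_gen x = [(x, True)]"

lemma inv_letter_inv_letter [simp]: "inv_letter (inv_letter l) = l"
  by (simp add: inv_letter_def)

lemma inv_letter_neq [simp]: "inv_letter l \<noteq> l" "l \<noteq> inv_letter l"
  by (auto simp: inv_letter_def prod_eq_iff)

lemma reduced_Nil [simp]: "reduced []"
  by (simp add: reduced_def)

lemma reduced_Cons: "reduced (l # w) \<longleftrightarrow> (w = [] \<or> hd w \<noteq> inv_letter l) \<and> reduced w"
  by (auto simp: reduced_def successively_Cons)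

lemma reduced_red_cons: "reduced w \<Longrightarrow> reduced (red_cons l w)"
  by (cases w) (auto simp: red_cons_def reduced_Cons)

lemma red_cons_cancel: "reduced w \<Longrightarrow> red_cons l (red_cons (inv_letter l) w) = w"
  by (cases w; cases "tl w") (auto simp: red_cons_def reduced_Cons)

lemma reduced_foldr_red_cons: "reduced w \<Longrightarrow> reduced (foldr red_cons u w)"
  by (induction u) (auto intro: reduced_red_cons)

lemma foldr_red_cons_red_cons:
  assumes "reduced w"
  shows "foldr red_cons (red_cons l v) w = red_cons l (foldr red_cons v w)"
proof (cases "v \<noteq> [] \<and> hd v = inv_letter l")
  case True
  then obtain v' where v: "v = inv_letter l # v'" by (cases v) auto
  then show ?thesis
    using red_cons_cancel[OF reduced_foldr_red_cons[OF assms], of l v']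
    by (simp add: red_cons_def[of l "inv_letter l # v'"])
qed (auto simp: red_cons_def[of l v])

lemma foldr_red_cons_assoc:
  assumes "reduced w"
  shows "foldr red_cons (foldr red_cons u v) w = foldr red_cons u (foldr red_cons v w)"
  by (induction u) (simp_all add: foldr_red_cons_red_cons[OF assms])

lemma foldr_red_cons_reduced: "reduced w \<Longrightarrow> foldr red_cons w [] = w"
  by (induction w) (auto simp: reduced_Cons red_cons_def)

lemma red_cons_in_lists:
  "l \<in> A \<times> UNIV \<Longrightarrow> w \<in> lists (A \<times> UNIV) \<Longrightarrow> red_cons l w \<in> lists (A \<times> UNIV)"
  by (cases w) (auto simp: red_cons_def)

lemma foldr_red_cons_in_lists:
  "u \<in> lists (A \<times> UNIV) \<Longrightarrow> w \<in> lists (A \<times> UNIV)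
    \<Longrightarrow> foldr red_cons u w \<in> lists (A \<times> UNIV)"
  by (induction u) (simp_all add: red_cons_in_lists del: in_lists_conv_set)

lemma foldr_red_cons_inverse:
  "reduced v \<Longrightarrow> foldr red_cons (rev (map inv_letter u)) (foldr red_cons u v) = v"
proof (induction u)
  case (Cons l u)
  have "red_cons (inv_letter l) (red_cons l (foldr red_cons u v)) = foldr red_cons u v"
    using red_cons_cancel[OF reduced_foldr_red_cons[OF Cons.prems], of "inv_letter l" u] by simp
  then show ?case using Cons by simp
qed simp

lemma free_group_group: "group (free_group A)"
proof (rule groupI)
  fix w assume w: "w \<in> carrier (free_group A)"
  let ?v = "foldr red_cons (rev (map inv_letter w)) []"
  have "rev (map inv_letter w) \<in> lists (A \<times> UNIV)"
    using w by (fastforce simp: free_group_def inv_letter_def mem_Times_iff)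
  then have "?v \<in> carrier (free_group A)"
    using foldr_red_cons_in_lists[of _ A "[]"]
    by (simp add: free_group_def reduced_foldr_red_cons)
  moreover have "?v \<otimes>\<^bsub>free_group A\<^esub> w = \<one>\<^bsub>free_group A\<^esub>"
    using w foldr_red_cons_inverse[of "[]" w]
    by (simp add: free_group_def foldr_red_cons_assoc foldr_red_cons_reduced)
  ultimately show "\<exists>v\<in>carrier (free_group A). v \<otimes>\<^bsub>free_group A\<^esub> w = \<one>\<^bsub>free_group A\<^esub>"
    by blast
next
  fix u v assume "u \<in> carrier (free_group A)" "v \<in> carrier (free_group A)"
  then show "u \<otimes>\<^bsub>free_group A\<^esub> v \<in> carrier (free_group A)"
    using foldr_red_cons_in_lists[of u A v] by (simp add: free_group_def reduced_foldr_red_cons)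
qed (auto simp: free_group_def foldr_red_cons_assoc)

lemma free_gen_closed: "x \<in> A \<Longrightarrow> free_gen x \<in> carrier (free_group A)"
  by (simp add: free_group_def free_gen_def reduced_Cons)

text \<open>The universal property of the free group.\<close>

definition free_lift :: "('b, 'm) monoid_scheme \<Rightarrow> ('a \<Rightarrow> 'b) \<Rightarrow> 'a letter list \<Rightarrow> 'b"
  where "free_lift G f w =
    foldr (\<lambda>l g. (if snd l then f (fst l) else inv\<^bsub>G\<^esub> f (fst l)) \<otimes>\<^bsub>G\<^esub> g) w \<one>\<^bsub>G\<^esub>"

context group
begin

lemma free_lift_closed:
  "f \<in> A \<rightarrow> carrier G \<Longrightarrow> w \<in> lists (A \<times> UNIV) \<Longrightarrow> free_lift G f w \<in> carrier G"
  by (induction w) (auto simp: free_lift_def Pi_iff)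

lemma free_lift_red_cons:
  assumes "f \<in> A \<rightarrow> carrier G" "l \<in> A \<times> UNIV" "w \<in> lists (A \<times> UNIV)"
  shows "free_lift G f (red_cons l w) =
    (if snd l then f (fst l) else inv f (fst l)) \<otimes> free_lift G f w"
proof (cases "w \<noteq> [] \<and> hd w = inv_letter l")
  case True
  then obtain w' where w: "w = inv_letter l # w'" by (cases w) auto
  have "free_lift G f w' \<in> carrier G" "f (fst l) \<in> carrier G"
    using assms w free_lift_closed[of f A w'] by auto
  then show ?thesis
    using w by (simp add: red_cons_def free_lift_def inv_letter_def m_assoc[symmetric])
qed (auto simp: red_cons_def free_lift_def)

lemma free_lift_hom:
  assumes "f \<in> A \<rightarrow> carrier G"
  shows "free_lift G f \<in> hom (free_group A) G"
proof (rule homI)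
  fix u v assume u: "u \<in> carrier (free_group A)" and v: "v \<in> carrier (free_group A)"
  have "u \<in> lists (A \<times> UNIV)" using u by (simp add: free_group_def)
  then have "free_lift G f (foldr red_cons u v) = free_lift G f u \<otimes> free_lift G f v"
  proof induction
    case Nil
    then show ?case
      using v free_lift_closed[OF assms, of v] by (simp add: free_lift_def[of _ _ "[]"] free_group_def)
  next
    case (Cons l u)
    let ?g = "if snd l then f (fst l) else inv f (fst l)"
    have g: "?g \<in> carrier G" using assms Cons by auto
    have c: "free_lift G f u \<in> carrier G" "free_lift G f v \<in> carrier G"
      using v Cons free_lift_closed[OF assms] by (auto simp: free_group_def)
    have "foldr red_cons u v \<in> lists (A \<times> UNIV)"
      using v Cons by (intro foldr_red_cons_in_lists) (auto simp: free_group_def)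
    then have "free_lift G f (foldr red_cons (l # u) v) = ?g \<otimes> free_lift G f (foldr red_cons u v)"
      using free_lift_red_cons[OF assms, of l] Cons.hyps by simp
    also have "\<dots> = (?g \<otimes> free_lift G f u) \<otimes> free_lift G f v"
      using g c Cons.IH by (simp only: m_assoc)
    also have "?g \<otimes> free_lift G f u = free_lift G f (l # u)"
      by (simp add: free_lift_def)
    finally show ?case .
  qed
  then show "free_lift G f (u \<otimes>\<^bsub>free_group A\<^esub> v) = free_lift G f u \<otimes> free_lift G f v"
    by (simp add: free_group_def)
qed (use free_lift_closed[OF assms] in \<open>simp add: free_group_def\<close>)

lemma free_lift_gen: "f x \<in> carrier G \<Longrightarrow> free_lift G f (free_gen x) = f x"
  by (simp add: free_lift_def free_gen_def)

lemma free_lift_unique: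
  assumes h: "h \<in> hom (free_group A) G" and f: "\<And>x. x \<in> A \<Longrightarrow> h (free_gen x) = f x"
    and w: "w \<in> carrier (free_group A)"
  shows "h w = free_lift G f w"
proof -
  interpret F: group "free_group A" by (rule free_group_group)
  interpret h: group_hom "free_group A" G h by unfold_locales (rule h)
  have letter: "h [l] = (if snd l then f (fst l) else inv f (fst l))" if "fst l \<in> A" for l
  proof (cases "snd l")
    case True
    then have "[l] = free_gen (fst l)" by (simp add: free_gen_def prod_eq_iff)
    then show ?thesis using f[OF that] True by simp
  next
    case False
    have l: "[l] \<in> carrier (free_group A)"
      using that by (simp add: free_group_def reduced_Cons mem_Times_iff)
    have "[l] \<otimes>\<^bsub>free_group A\<^esub> free_gen (fst l) = \<one>\<^bsub>free_group A\<^esub>"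
      using False by (simp add: free_group_def free_gen_def red_cons_def inv_letter_def)
    then have "inv\<^bsub>free_group A\<^esub> (free_gen (fst l)) = [l]"
      using free_gen_closed[OF that] l by (rule F.inv_equality)
    then show ?thesis
      using h.hom_inv[OF free_gen_closed[OF that]] f[OF that] False by simp
  qed
  have "w \<in> lists (A \<times> UNIV)" "reduced w" using w by (auto simp: free_group_def)
  then show ?thesis
  proof (induction w)
    case Nil
    then show ?case using h.hom_one by (simp add: free_lift_def free_group_def)
  next
    case (Cons l w)
    have c: "[l] \<in> carrier (free_group A)" "w \<in> carrier (free_group A)"
      using Cons by (auto simp: free_group_def reduced_Cons simp del: in_lists_conv_set)
    have "l # w = [l] \<otimes>\<^bsub>free_group A\<^esub> w"
      using Cons.prems by (auto simp: free_group_def red_cons_def reduced_Cons)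
    then have "h (l # w) = h [l] \<otimes> h w" using h.hom_mult[OF c] by simp
    then show ?case
      using Cons.IH Cons.prems letter[of l] Cons.hyps
      by (auto simp: reduced_Cons free_lift_def)
  qed
qed

end


section \<open>Finite \<open>L\<close>-presentations\<close>

definition normal_closure :: "('a, 'b) monoid_scheme \<Rightarrow> 'a set \<Rightarrow> 'a set"
  where "normal_closure G S = \<Inter>{N. N \<lhd> G \<and> S \<subseteq> N}"

text \<open>
  The monoid of maps generated by \<open>\<Phi>\<close>. As a set it does not depend on whether maps
  are composed from the left or, as with exponent notation, from the right.
\<close>

inductive_set endo_monoid :: "('a \<Rightarrow> 'a) set \<Rightarrow> ('a \<Rightarrow> 'a) set" for \<Phi>
  where
    id: "id \<in> endo_monoid \<Phi>"
  | comp: "\<lbrakk>\<phi> \<in> \<Phi>; \<sigma> \<in> endo_monoid \<Phi>\<rbrakk> \<Longrightarrow> \<phi> \<circ> \<sigma> \<in> endo_monoid \<Phi>"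

definition finite_L_presentation ::
    "'a set \<Rightarrow> 'a letter list set \<Rightarrow> ('a letter list \<Rightarrow> 'a letter list) set \<Rightarrow> 'a letter list set \<Rightarrow> bool"
  where "finite_L_presentation A Q \<Phi> R \<longleftrightarrow>
    finite A \<and>
    finite Q \<and> Q \<subseteq> carrier (free_group A) \<and>
    finite \<Phi> \<and> \<Phi> \<subseteq> hom (free_group A) (free_group A) \<and>
    finite R \<and> R \<subseteq> carrier (free_group A)"

definition L_kernel ::
    "'a set \<Rightarrow> 'a letter list set \<Rightarrow> ('a letter list \<Rightarrow> 'a letter list) set \<Rightarrow> 'a letter list set
      \<Rightarrow> 'a letter list set"
  where "L_kernel A Q \<Phi> R =
    normal_closure (free_group A) (Q \<union> (\<Union>\<sigma>\<in>endo_monoid \<Phi>. \<sigma> ` R))"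

definition L_group ::
    "'a set \<Rightarrow> 'a letter list set \<Rightarrow> ('a letter list \<Rightarrow> 'a letter list) set \<Rightarrow> 'a letter list set
      \<Rightarrow> 'a letter list set monoid"
  where "L_group A Q \<Phi> R = free_group A Mod L_kernel A Q \<Phi> R"

definition invariant_finite_L_presentation ::
    "'a set \<Rightarrow> 'a letter list set \<Rightarrow> ('a letter list \<Rightarrow> 'a letter list) set \<Rightarrow> 'a letter list set \<Rightarrow> bool"
  where "invariant_finite_L_presentation A Q \<Phi> R \<longleftrightarrow>
    finite_L_presentation A Q \<Phi> R \<and> (\<forall>\<phi>\<in>\<Phi>. \<phi> ` L_kernel A Q \<Phi> R \<subseteq> L_kernel A Q \<Phi> R)"

text \<open>
  HOL cannot quantify over the type of the letters inside a formula; since alphabets are finite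
  and may be renamed, it is enough to consider alphabets of natural numbers.
\<close>

definition invariantly_finitely_L_presented :: "('g, 'm) monoid_scheme \<Rightarrow> bool"
  where "invariantly_finitely_L_presented G \<longleftrightarrow>
    group G \<and>
    (\<exists>(A :: nat set) Q \<Phi> R. invariant_finite_L_presentation A Q \<Phi> R \<and> G \<cong> L_group A Q \<Phi> R)"

text \<open>
  The endomorphism of \<open>G Mod K\<close> induced by an endomorphism \<open>\<phi>\<close> of \<open>G\<close> with
  \<open>\<phi> ` K \<subseteq> K\<close>: it maps the coset of \<open>g\<close> to the coset of \<open>\<phi> g\<close>
  (see \<open>induced_endo_rcos\<close> below).
\<close>

definition induced_endo :: "('a, 'b) monoid_scheme \<Rightarrow> 'a set \<Rightarrow> ('a \<Rightarrow> 'a) \<Rightarrow> 'a set \<Rightarrow> 'a set"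
  where "induced_endo G K \<phi> C = (\<Union>g\<in>C. K #>\<^bsub>G\<^esub> \<phi> g)"

lemma (in group) normal_closure_normal:
  assumes "S \<subseteq> carrier G"
  shows "normal_closure G S \<lhd> G"
proof -
  let ?A = "{N. N \<lhd> G \<and> S \<subseteq> N}"
  have "carrier G \<lhd> G" by (simp add: normal_inv_iff subgroup_self)
  then have "?A \<noteq> {}" using assms by blast
  moreover have "\<And>N. N \<in> ?A \<Longrightarrow> subgroup N G" by (simp add: normal_imp_subgroup)
  ultimately have "subgroup (\<Inter>?A) G" by (intro subgroups_Inter) auto
  moreover have "x \<otimes> h \<otimes> inv x \<in> \<Inter>?A" if "x \<in> carrier G" "h \<in> \<Inter>?A" for x h
    using that normal_inv_iff by blast
  ultimately show ?thesis unfolding normal_closure_def by (intro normal_invI)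
qed

lemma endo_monoid_hom:
  assumes "\<Phi> \<subseteq> hom G G" "\<sigma> \<in> endo_monoid \<Phi>"
  shows "\<sigma> \<in> hom G G"
  using assms(2)
proof induction
  case id
  show ?case by (simp add: hom_def)
next
  case (comp \<phi> \<sigma>)
  then have "\<phi> \<in> hom G G" using assms(1) by blast
  then show ?case using comp.IH hom_compose by blast
qed

lemma L_kernel_normal:
  assumes "finite_L_presentation A Q \<Phi> R"
  shows "L_kernel A Q \<Phi> R \<lhd> free_group A"
proof -
  have "\<sigma> ` R \<subseteq> carrier (free_group A)" if "\<sigma> \<in> endo_monoid \<Phi>" for \<sigma>
    using assms endo_monoid_hom[OF _ that, of "free_group A"]
    unfolding finite_L_presentation_def hom_def by blast
  then show ?thesis
    unfolding L_kernel_def using assms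
    by (intro group.normal_closure_normal free_group_group) (auto simp: finite_L_presentation_def)
qed

lemma L_group_group:
  "finite_L_presentation A Q \<Phi> R \<Longrightarrow> group (L_group A Q \<Phi> R)"
  unfolding L_group_def by (intro normal.factorgroup_is_group L_kernel_normal)

lemma (in normal) induced_endo_rcos:
  assumes \<phi>: "\<phi> \<in> hom G G" and inv: "\<phi> ` H \<subseteq> H" and g: "g \<in> carrier G"
  shows "induced_endo G H \<phi> (H #> g) = H #> \<phi> g"
proof -
  have \<phi>c: "\<phi> x \<in> carrier G" if "x \<in> carrier G" for x
    using \<phi> that by (auto simp: hom_def)
  have "H #> \<phi> x = H #> \<phi> g" if x: "x \<in> H #> g" for x
  proof -
    obtain h where h: "h \<in> H" "x = h \<otimes> g" using x by (auto simp: r_coset_def)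
    have "\<phi> x = \<phi> h \<otimes> \<phi> g" using h g \<phi> by (auto simp: hom_def)
    moreover have "\<phi> h \<in> H" using h inv by blast
    ultimately have "\<phi> x \<in> H #> \<phi> g" by (auto simp: r_coset_def)
    then show ?thesis using repr_independence[OF _ \<phi>c[OF g] is_subgroup] by simp
  qed
  moreover have "g \<in> H #> g" using g is_subgroup by (rule rcos_self)
  ultimately show ?thesis unfolding induced_endo_def by blast
qed

lemma (in normal) induced_endo_hom:
  assumes \<phi>: "\<phi> \<in> hom G G" and inv: "\<phi> ` H \<subseteq> H"
  shows "induced_endo G H \<phi> \<in> hom (G Mod H) (G Mod H)"
proof (rule homI)
  fix C assume "C \<in> carrier (G Mod H)"
  then obtain g where g: "g \<in> carrier G" "C = H #> g" by (auto simp: FactGroup_def RCOSETS_def)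
  then have "\<phi> g \<in> carrier G" using \<phi> by (auto simp: hom_def)
  then show "induced_endo G H \<phi> C \<in> carrier (G Mod H)"
    using g induced_endo_rcos[OF \<phi> inv] by (auto simp: FactGroup_def RCOSETS_def)
next
  fix C D assume "C \<in> carrier (G Mod H)" "D \<in> carrier (G Mod H)"
  then obtain g k where g: "g \<in> carrier G" "C = H #> g" and k: "k \<in> carrier G" "D = H #> k"
    by (auto simp: FactGroup_def RCOSETS_def)
  have "\<phi> g \<in> carrier G" "\<phi> k \<in> carrier G" "\<phi> (g \<otimes> k) = \<phi> g \<otimes> \<phi> k"
    using \<phi> g k by (auto simp: hom_def)
  then show "induced_endo G H \<phi> (C \<otimes>\<^bsub>G Mod H\<^esub> D) =
      induced_endo G H \<phi> C \<otimes>\<^bsub>G Mod H\<^esub> induced_endo G H \<phi> D"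
    using g k by (simp add: FactGroup_def rcos_sum induced_endo_rcos[OF \<phi> inv])
qed

end

theory Submission
  imports Defs
begin

text \<open>
  Let \<open>V\<close> be the preimage of \<open>U\<close> in the free group \<open>F\<close>, and \<open>K\<close> the kernel of the presentation.
  Instead of a Schreier basis of \<open>V\<close> we use that \<open>V\<close> is a retract of a free group \<open>H\<close> of finite
  rank: there are \<open>\<pi> : H \<rightarrow> V\<close> and a homomorphic section \<open>s : V \<rightarrow> H\<close>. Then \<open>ker \<pi>\<close> is the normal
  closure of the finitely many elements \<open>y\<inverse> s(\<pi> y)\<close>, \<open>y\<close> a free generator, and every endomorphism
  \<open>\<phi>\<close> of \<open>V\<close> lifts to the endomorphism \<open>s \<circ> \<phi> \<circ> \<pi>\<close> of \<open>H\<close>. Lifting the elements of \<open>\<Phi>\<close>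
  together with the conjugations by a finite transversal of \<open>V\<close> in \<open>F\<close> lets the iterated relators
  produce all \<open>F\<close>-conjugates of the relators in \<open>K\<close>, so that the new kernel is \<open>\<pi>\<inverse>(K)\<close>.
\<close>

section \<open>Transversals of subgroups of finite index\<close>

lemma (in group) inv_mult_cancel:
  "x \<in> carrier G \<Longrightarrow> y \<in> carrier G \<Longrightarrow> x \<otimes> (inv x \<otimes> y) = y"
  "x \<in> carrier G \<Longrightarrow> y \<in> carrier G \<Longrightarrow> inv x \<otimes> (x \<otimes> y) = y"
  by (simp_all add: m_assoc[symmetric])

text \<open>The representatives wanted are those of the left cosets \<open>gV\<close>, while
  \<open>rcosets V\<close> consists of right cosets. Inversion exchanges the two, so
  \<open>rep g\<close> is taken as the inverse of an element chosen from
  \<open>V #> inv g\<close>.\<close>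

lemma (in group) finite_index_transversal:
  assumes V: "subgroup V G" and fin: "finite (rcosets V)"
  obtains rep where "rep \<in> carrier G \<rightarrow> carrier G" "finite (rep ` carrier G)"
    "\<And>g. g \<in> carrier G \<Longrightarrow> inv (rep g) \<otimes> g \<in> V"
    "\<And>g h. \<lbrakk>g \<in> carrier G; h \<in> carrier G; inv g \<otimes> h \<in> V\<rbrakk> \<Longrightarrow> rep g = rep h"
    "\<And>g. g \<in> V \<Longrightarrow> rep g = \<one>"
proof
  interpret V: subgroup V G by (rule V)
  \<comment> \<open>The value at \<open>V\<close> itself is fixed so that the trivial coset is
    represented by the identity, as the last claim demands.\<close>
  define r where "r C = (if C = V then \<one> else SOME h. h \<in> C)" for C
  let ?rep = "\<lambda>g. inv (r (V #> inv g))"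
  have r: "r (V #> g) \<in> V #> g" if "g \<in> carrier G" for g
    using someI[of "\<lambda>h. h \<in> V #> g", OF rcos_self[OF that V]] by (auto simp: r_def)
  have rc: "r (V #> g) \<in> carrier G" if "g \<in> carrier G" for g
    using r[OF that] r_coset_subset_G[OF V.subset that] by blast
  show "?rep \<in> carrier G \<rightarrow> carrier G" using rc by auto
  have "?rep ` carrier G \<subseteq> (\<lambda>C. inv (r C)) ` (rcosets V)"
    by (auto simp: RCOSETS_def)
  then show "finite (?rep ` carrier G)" using fin finite_surj by blast
  show "inv (?rep g) \<otimes> g \<in> V" if g: "g \<in> carrier G" for g
  proof -
    obtain v where v: "v \<in> V" "r (V #> inv g) = v \<otimes> inv g"
      using r[of "inv g"] g by (auto simp: r_coset_def)
    then have "v \<in> carrier G" by simp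
    then show ?thesis using v g by (simp add: m_assoc)
  qed
  show "?rep g = ?rep h" if "g \<in> carrier G" "h \<in> carrier G" "inv g \<otimes> h \<in> V" for g h
  proof -
    have "inv g = (inv g \<otimes> h) \<otimes> inv h" using that by (simp add: m_assoc)
    then have "inv g \<in> V #> inv h" using that by (auto simp: r_coset_def)
    then have "V #> inv h = V #> inv g" using that V by (intro repr_independence) auto
    then show ?thesis by simp
  qed
  show "?rep g = \<one>" if "g \<in> V" for g
    using that coset_join2[of "inv g" V] V by (simp add: r_def)
qed

section \<open>Actions and homomorphisms of free groups\<close>

lemma foldr_step_closed:
  assumes "\<And>l p. \<lbrakk>l \<in> A \<times> UNIV; p \<in> P\<rbrakk> \<Longrightarrow> step l p \<in> P"
  shows "w \<in> lists (A \<times> UNIV) \<Longrightarrow> p \<in> P \<Longrightarrow> foldr step w p \<in> P"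
  by (induction w) (auto simp: assms simp del: in_lists_conv_set)

text \<open>Multiplication in the free group differs from concatenation only by cancelling a letter
  against its inverse, and by \<open>inv\<close> such a pair of steps has no effect on
  \<open>P\<close>. Thus invertible steps, given letter by letter, yield a left action of the free
  group.\<close>

lemma foldr_step_mult:
  assumes closed: "\<And>l p. \<lbrakk>l \<in> A \<times> UNIV; p \<in> P\<rbrakk> \<Longrightarrow> step l p \<in> P"
    and inv: "\<And>l p. \<lbrakk>l \<in> A \<times> UNIV; p \<in> P\<rbrakk> \<Longrightarrow> step l (step (inv_letter l) p) = p"
    and u: "u \<in> lists (A \<times> UNIV)" and v: "v \<in> lists (A \<times> UNIV)" and p: "p \<in> P"
  shows "foldr step (foldr red_cons u v) p = foldr step u (foldr step v p)"
  using u
proof induction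
  case (Cons l u)
  have red: "foldr step (red_cons l w) p = step l (foldr step w p)"
    if w: "w \<in> lists (A \<times> UNIV)" for w
  proof (cases "w \<noteq> [] \<and> hd w = inv_letter l")
    case True
    then obtain w' where w': "w = inv_letter l # w'" by (cases w) auto
    then have "foldr step w' p \<in> P" using w p foldr_step_closed[of A P step w' p, OF closed]
      by (auto simp del: in_lists_conv_set)
    then show ?thesis using w' inv Cons.hyps by (simp add: red_cons_def)
  qed (auto simp: red_cons_def)
  show ?case using red[OF foldr_red_cons_in_lists[OF Cons.hyps(2) v]] Cons.IH by simp
qed simp

text \<open>Modulo \<open>M\<close> the map \<theta> and the identity agree on the free generators,
  hence everywhere, since a homomorphism is determined by its values there. Applied to
  \<open>s \<circ> \<pi>\<close>, this controls the kernel of \<open>\<pi>\<close>.\<close>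

lemma normal_contains_displacement:
  assumes M: "M \<lhd> free_group B" and \<theta>: "\<theta> \<in> hom (free_group B) (free_group B)"
    and gen: "\<And>x. x \<in> B \<Longrightarrow> inv\<^bsub>free_group B\<^esub> free_gen x \<otimes>\<^bsub>free_group B\<^esub> \<theta> (free_gen x) \<in> M"
    and w: "w \<in> carrier (free_group B)"
  shows "inv\<^bsub>free_group B\<^esub> w \<otimes>\<^bsub>free_group B\<^esub> \<theta> w \<in> M"
proof -
  let ?F = "free_group B"
  interpret M: normal M ?F by (rule M)
  interpret Q: group "?F Mod M" by (rule M.factorgroup_is_group)
  \<comment> \<open>By normality right cosets are left cosets, which turns equality of cosets into
    the form in which displacements occur.\<close>
  have coset_eq: "M #>\<^bsub>?F\<^esub> u = M #>\<^bsub>?F\<^esub> v \<longleftrightarrow> inv\<^bsub>?F\<^esub> u \<otimes>\<^bsub>?F\<^esub> v \<in> M"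
    if uv: "u \<in> carrier ?F" "v \<in> carrier ?F" for u v
  proof
    assume "M #>\<^bsub>?F\<^esub> u = M #>\<^bsub>?F\<^esub> v"
    then have "v \<in> u <#\<^bsub>?F\<^esub> M"
      using M.rcos_self[OF uv(2) M.is_subgroup] M.coset_eq uv by simp
    then obtain m where m: "m \<in> M" "v = u \<otimes>\<^bsub>?F\<^esub> m" by (auto simp: l_coset_def)
    then show "inv\<^bsub>?F\<^esub> u \<otimes>\<^bsub>?F\<^esub> v \<in> M" using uv by (simp add: M.m_assoc[symmetric])
  next
    assume "inv\<^bsub>?F\<^esub> u \<otimes>\<^bsub>?F\<^esub> v \<in> M"
    moreover have "v = u \<otimes>\<^bsub>?F\<^esub> (inv\<^bsub>?F\<^esub> u \<otimes>\<^bsub>?F\<^esub> v)" using uv by (simp add: M.m_assoc[symmetric])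
    ultimately have "v \<in> u <#\<^bsub>?F\<^esub> M" unfolding l_coset_def by blast
    then show "M #>\<^bsub>?F\<^esub> u = M #>\<^bsub>?F\<^esub> v"
      using uv M.coset_eq by (intro M.repr_independence[OF _ _ M.is_subgroup]) auto
  qed
  have q: "(\<lambda>w. M #>\<^bsub>?F\<^esub> w) \<in> hom ?F (?F Mod M)" by (rule M.r_coset_hom_Mod)
  have \<theta>c: "\<theta> u \<in> carrier ?F" if "u \<in> carrier ?F" for u using \<theta> that by (auto simp: hom_def)
  have "M #>\<^bsub>?F\<^esub> w = free_lift (?F Mod M) (\<lambda>x. M #>\<^bsub>?F\<^esub> free_gen x) w"
    by (rule Q.free_lift_unique[OF q _ w]) simp
  moreover have "M #>\<^bsub>?F\<^esub> \<theta> w = free_lift (?F Mod M) (\<lambda>x. M #>\<^bsub>?F\<^esub> free_gen x) w"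
  proof -
    have "M #>\<^bsub>?F\<^esub> \<theta> (free_gen x) = M #>\<^bsub>?F\<^esub> free_gen x" if "x \<in> B" for x
      using gen[OF that] coset_eq[OF free_gen_closed[OF that] \<theta>c[OF free_gen_closed[OF that]]] by simp
    then show ?thesis
      using Q.free_lift_unique[OF hom_compose[OF \<theta> q] _ w, of "\<lambda>x. M #>\<^bsub>?F\<^esub> free_gen x"] by simp
  qed
  ultimately show ?thesis using coset_eq[OF w \<theta>c[OF w]] by simp
qed

lemma (in group) normal_closure_subset:
  "N \<lhd> G \<Longrightarrow> S \<subseteq> N \<Longrightarrow> normal_closure G S \<subseteq> N"
  unfolding normal_closure_def by blast

lemma normal_closure_superset: "S \<subseteq> normal_closure G S"
  unfolding normal_closure_def by blast

section \<open>Finite-index subgroups as retracts of free groups of finite rank\<close>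

lemma letter_closed: "l \<in> A \<times> UNIV \<Longrightarrow> [l] \<in> carrier (free_group A)"
  by (simp add: free_group_def reduced_Cons)

lemma letter_inverse: "[l] \<otimes>\<^bsub>free_group A\<^esub> [inv_letter l] = \<one>\<^bsub>free_group A\<^esub>"
  by (simp add: free_group_def red_cons_def)

text \<open>
  \<open>H\<close> is free on symbols \<open>(x, t)\<close>, for \<open>x\<close> a generator and \<open>t\<close> a coset representative, and \<open>\<pi>\<close>
  maps \<open>(x, t)\<close> to the Reidemeister-Schreier generator \<open>(rep (x t))\<inverse> x t\<close>. The section is read off
  from an action of the free group on \<open>T \<times> H\<close> commuting with right multiplication on \<open>H\<close>.
\<close>

lemma free_group_finite_index_retract:
  fixes A :: "'a set"
  assumes A: "finite A" and V: "subgroup V (free_group A)"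
    and fin: "finite (rcosets\<^bsub>free_group A\<^esub> V)"
  obtains B :: "nat set" and \<pi> s where "finite B"
    "\<pi> \<in> hom (free_group B) ((free_group A)\<lparr>carrier := V\<rparr>)"
    "s \<in> hom ((free_group A)\<lparr>carrier := V\<rparr>) (free_group B)"
    "\<And>v. v \<in> V \<Longrightarrow> \<pi> (s v) = v"
proof -
  define F where "F = free_group A"
  interpret F: group F unfolding F_def by (rule free_group_group)
  interpret V: subgroup V F using V by (simp add: F_def)
  interpret FV: group "F\<lparr>carrier := V\<rparr>" by (rule V.subgroup_is_group[OF F.is_group])
  obtain rep where rep_closed: "rep \<in> carrier F \<rightarrow> carrier F"
    and rep_finite: "finite (rep ` carrier F)"
    and rep_V: "\<And>g. g \<in> carrier F \<Longrightarrow> inv\<^bsub>F\<^esub> rep g \<otimes>\<^bsub>F\<^esub> g \<in> V"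
    and rep_eq: "\<And>g h. \<lbrakk>g \<in> carrier F; h \<in> carrier F; inv\<^bsub>F\<^esub> g \<otimes>\<^bsub>F\<^esub> h \<in> V\<rbrakk> \<Longrightarrow> rep g = rep h"
    and rep_one: "\<And>g. g \<in> V \<Longrightarrow> rep g = \<one>\<^bsub>F\<^esub>"
    by (rule F.finite_index_transversal[OF V.subgroup_axioms]) (use fin in \<open>auto simp: F_def\<close>)
  define T where "T = rep ` carrier F"
  have T_closed: "t \<in> carrier F" if "t \<in> T" for t using that rep_closed by (auto simp: T_def)
  have rep_T: "rep t = t" if "t \<in> T" for t
  proof -
    obtain g where g: "g \<in> carrier F" "t = rep g" using \<open>t \<in> T\<close> by (auto simp: T_def)
    then show ?thesis using rep_eq[OF T_closed[OF \<open>t \<in> T\<close>] g(1)] rep_V[OF g(1)] by simp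
  qed
  have rep_mult: "rep (g \<otimes>\<^bsub>F\<^esub> v) = rep g" if "g \<in> carrier F" "v \<in> V" for g v
    using that by (intro rep_eq[symmetric]) (simp_all add: F.inv_mult_cancel)
  \<comment> \<open>Left multiplication permutes the left cosets of \<open>V\<close>, so replacing
    \<open>h\<close> by its representative does not alter the coset of the product. Hence the free
    group acts on \<open>T\<close>.\<close>
  have rep_rep: "rep (g \<otimes>\<^bsub>F\<^esub> rep h) = rep (g \<otimes>\<^bsub>F\<^esub> h)" if "g \<in> carrier F" "h \<in> carrier F" for g h
  proof -
    have r: "rep h \<in> carrier F" using that rep_closed by auto
    have "rep (g \<otimes>\<^bsub>F\<^esub> h) = rep (g \<otimes>\<^bsub>F\<^esub> rep h \<otimes>\<^bsub>F\<^esub> (inv\<^bsub>F\<^esub> rep h \<otimes>\<^bsub>F\<^esub> h))"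
      using that r by (simp add: F.m_assoc F.inv_mult_cancel)
    then show ?thesis using rep_mult rep_V that r by simp
  qed
  \<comment> \<open>The pairs \<open>(x, t)\<close> are coded by natural numbers, since the alphabet
    of the presentation to be built has to be a set of naturals.\<close>
  have "finite (A \<times> T)" using A rep_finite by (simp add: T_def)
  then obtain e :: "'a \<times> 'a letter list \<Rightarrow> nat" where e: "inj_on e (A \<times> T)"
    using finite_imp_inj_to_nat_seg by blast
  define B where "B = e ` (A \<times> T)"
  have B: "finite B" using \<open>finite (A \<times> T)\<close> by (simp add: B_def)
  define H where "H = free_group B"
  interpret H: group H unfolding H_def by (rule free_group_group)
  define y where "y x t = free_gen (e (x, t))" for x t
  have y: "y x t \<in> carrier H" if "x \<in> A" "t \<in> T" for x t
    using that free_gen_closed[of "e (x, t)" B] by (auto simp: y_def B_def H_def)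
  define c where "c x t = inv\<^bsub>F\<^esub> rep ([(x, True)] \<otimes>\<^bsub>F\<^esub> t) \<otimes>\<^bsub>F\<^esub> ([(x, True)] \<otimes>\<^bsub>F\<^esub> t)" for x t
  have gen: "[l] \<in> carrier F" if "fst l \<in> A" for l
    using that letter_closed[of l A] by (simp add: F_def mem_Times_iff)
  have c: "c x t \<in> V" if "x \<in> A" "t \<in> T" for x t
    using that gen[of "(x, True)"] T_closed rep_V by (simp add: c_def)
  define \<pi> where "\<pi> = free_lift (F\<lparr>carrier := V\<rparr>) (\<lambda>i. case_prod c (inv_into (A \<times> T) e i))"
  have "(\<lambda>i. case_prod c (inv_into (A \<times> T) e i)) \<in> B \<rightarrow> carrier (F\<lparr>carrier := V\<rparr>)"
    using c e by (auto simp: B_def)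
  then have \<pi>: "\<pi> \<in> hom H (F\<lparr>carrier := V\<rparr>)"
    unfolding \<pi>_def H_def by (rule FV.free_lift_hom)
  have \<pi>_y: "\<pi> (y x t) = c x t" if "x \<in> A" "t \<in> T" for x t
    using that e c FV.free_lift_gen[of "\<lambda>i. case_prod c (inv_into (A \<times> T) e i)" "e (x, t)"]
    by (simp add: \<pi>_def y_def)
  have \<pi>_V: "\<pi> w \<in> V" if "w \<in> carrier H" for w using \<pi> that by (auto simp: hom_def)
  interpret \<pi>: group_hom H F \<pi>
    using \<pi> \<pi>_V V.mem_carrier by unfold_locales (auto simp: hom_def)

  \<comment> \<open>A positive letter \<open>x\<close> moves \<open>t\<close> to the representative
    of \<open>x t\<close> and multiplies by the symbol \<open>y x t\<close>. A negative letter has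
    to undo this, so it uses the inverse of the symbol that leads from the new \<open>t'\<close>
    back to \<open>t\<close>.\<close>
  define step where "step = (\<lambda>l (t, f). let t' = rep ([l] \<otimes>\<^bsub>F\<^esub> t) in
    (t', (if snd l then y (fst l) t else inv\<^bsub>H\<^esub> y (fst l) t') \<otimes>\<^bsub>H\<^esub> f))"
  have T_step: "rep ([l] \<otimes>\<^bsub>F\<^esub> t) \<in> T" if "l \<in> A \<times> UNIV" "t \<in> T" for l t
    using that gen[of l] T_closed by (auto simp: T_def)
  have closed: "step l p \<in> T \<times> carrier H" if "l \<in> A \<times> UNIV" "p \<in> T \<times> carrier H" for l p
    using that T_step[of l "fst p"] y by (auto simp: step_def Let_def)
  have rep_back: "rep ([l] \<otimes>\<^bsub>F\<^esub> rep ([inv_letter l] \<otimes>\<^bsub>F\<^esub> t)) = t" if "l \<in> A \<times> UNIV" "t \<in> T" for l t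
  proof -
    have c: "[l] \<in> carrier F" "[inv_letter l] \<in> carrier F" "t \<in> carrier F"
      using that T_closed by (auto intro!: gen simp: inv_letter_def)
    have "[l] \<otimes>\<^bsub>F\<^esub> ([inv_letter l] \<otimes>\<^bsub>F\<^esub> t) = t"
      using c letter_inverse[of A l] by (simp add: F.m_assoc[symmetric] F_def[symmetric])
    then show ?thesis using c that rep_T by (simp add: rep_rep)
  qed
  have inverse: "step l (step (inv_letter l) p) = p" if l: "l \<in> A \<times> UNIV" and p: "p \<in> T \<times> carrier H" for l p
  proof -
    obtain t f where tf: "p = (t, f)" "t \<in> T" "f \<in> carrier H" using p by auto
    have l': "inv_letter l \<in> A \<times> UNIV" using l by (auto simp: inv_letter_def)
    have fst: "fst l \<in> A" using l by auto
    have y': "y (fst l) t \<in> carrier H" "y (fst l) (rep ([inv_letter l] \<otimes>\<^bsub>F\<^esub> t)) \<in> carrier H"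
      using y[OF fst] T_step[OF l' tf(2)] tf(2) by auto
    show ?thesis
      using tf y' rep_back[OF l tf(2)]
      by (cases "snd l") (simp_all add: step_def Let_def inv_letter_def H.inv_mult_cancel)
  qed
  \<comment> \<open>\<open>val\<close> intertwines the action on \<open>T \<times> H\<close> with left multiplication on \<open>F\<close>.\<close>
  define val where "val = (\<lambda>(t, f). t \<otimes>\<^bsub>F\<^esub> \<pi> f)"
  have val_step: "val (step l p) = [l] \<otimes>\<^bsub>F\<^esub> val p" if l: "l \<in> A \<times> UNIV" and p: "p \<in> T \<times> carrier H" for l p
  proof -
    obtain t f where tf: "p = (t, f)" "t \<in> T" "f \<in> carrier H" using p by auto
    have fst: "fst l \<in> A" using l by auto
    define t' where "t' = rep ([l] \<otimes>\<^bsub>F\<^esub> t)"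
    have t': "t' \<in> T" using T_step l tf by (simp add: t'_def)
    have gl: "[l] \<in> carrier F" using l by (auto intro!: gen)
    note cl = gl T_closed[OF t'] T_closed[OF tf(2)] \<pi>.hom_closed[OF tf(3)]
    show ?thesis
    proof (cases "snd l")
      case True
      then have "l = (fst l, True)" by (simp add: prod_eq_iff)
      then have "\<pi> (y (fst l) t) = inv\<^bsub>F\<^esub> t' \<otimes>\<^bsub>F\<^esub> ([l] \<otimes>\<^bsub>F\<^esub> t)"
        using \<pi>_y[OF fst tf(2)] by (simp add: c_def t'_def)
      then have "val (step l p) = t' \<otimes>\<^bsub>F\<^esub> (inv\<^bsub>F\<^esub> t' \<otimes>\<^bsub>F\<^esub> ([l] \<otimes>\<^bsub>F\<^esub> t) \<otimes>\<^bsub>F\<^esub> \<pi> f)"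
        using True y[OF fst tf(2)] tf(3) by (simp add: tf(1) step_def val_def Let_def t'_def)
      also have "\<dots> = [l] \<otimes>\<^bsub>F\<^esub> val p"
        using cl by (simp add: tf(1) val_def F.m_assoc F.inv_mult_cancel)
      finally show ?thesis .
    next
      case False
      have "inv_letter l = (fst l, True)" using False by (simp add: inv_letter_def)
      moreover have "rep ([inv_letter l] \<otimes>\<^bsub>F\<^esub> t') = t"
        using rep_back[of "inv_letter l" t] l tf(2) by (auto simp: t'_def inv_letter_def)
      moreover have "inv\<^bsub>F\<^esub> [l] = [inv_letter l]"
        using letter_inverse[of A "inv_letter l"] fst
        by (intro F.inv_equality) (auto intro!: gen simp: F_def[symmetric] inv_letter_def)
      \<comment> \<open>The positive letter leads from \<open>t'\<close> to \<open>t\<close>, so the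
        Reidemeister-Schreier generator at \<open>t'\<close> is formed with \<open>t\<close> as
        representative; the step multiplies by the inverse of its symbol.\<close>
      ultimately have "\<pi> (y (fst l) t') = inv\<^bsub>F\<^esub> t \<otimes>\<^bsub>F\<^esub> (inv\<^bsub>F\<^esub> [l] \<otimes>\<^bsub>F\<^esub> t')"
        using \<pi>_y[OF fst t'] by (simp add: c_def)
      then have "val (step l p) =
          t' \<otimes>\<^bsub>F\<^esub> (inv\<^bsub>F\<^esub> (inv\<^bsub>F\<^esub> t \<otimes>\<^bsub>F\<^esub> (inv\<^bsub>F\<^esub> [l] \<otimes>\<^bsub>F\<^esub> t')) \<otimes>\<^bsub>F\<^esub> \<pi> f)"
        using False y[OF fst t'] tf(3) by (simp add: tf(1) step_def val_def Let_def t'_def[symmetric])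
      also have "\<dots> = [l] \<otimes>\<^bsub>F\<^esub> val p"
        using cl by (simp add: tf(1) val_def F.inv_mult_group F.m_assoc F.inv_mult_cancel)
      finally show ?thesis .
    qed
  qed

  have words: "w \<in> lists (A \<times> UNIV)" if "w \<in> V" for w
    using V.mem_carrier[OF that] by (simp add: F_def free_group_def)
  have fold_closed: "foldr step w p \<in> T \<times> carrier H"
    if "w \<in> lists (A \<times> UNIV)" "p \<in> T \<times> carrier H" for w p
    using foldr_step_closed[of A "T \<times> carrier H" step, OF closed] that by blast
  have val_fold: "val (foldr step w p) = foldr red_cons w (val p)"
    if p: "p \<in> T \<times> carrier H" and w: "w \<in> lists (A \<times> UNIV)" for w p
    using w
  proof induction
    case (Cons l w)
    then show ?case using val_step[OF Cons.hyps(1) fold_closed[OF Cons.hyps(2) p]]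
      by (simp add: F_def free_group_def)
  qed simp
  \<comment> \<open>A step changes the second component only by left multiplication, with a factor
    that depends on the letter and on the first component alone.\<close>
  have equivariant: "foldr step w (t, f \<otimes>\<^bsub>H\<^esub> h) =
      (fst (foldr step w (t, f)), snd (foldr step w (t, f)) \<otimes>\<^bsub>H\<^esub> h)"
    if "t \<in> T" "f \<in> carrier H" "h \<in> carrier H" and w: "w \<in> lists (A \<times> UNIV)" for w t f h
    using w
  proof induction
    case (Cons l w)
    obtain t' f' where tf: "foldr step w (t, f) = (t', f')" by (cases "foldr step w (t, f)")
    then have "t' \<in> T" "f' \<in> carrier H" using fold_closed[OF Cons.hyps(2), of "(t, f)"] that by auto
    moreover have "fst l \<in> A" using Cons.hyps by auto
    ultimately show ?case
      using Cons.IH tf that y[of "fst l"] T_step[OF Cons.hyps(1)]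
      by (simp add: step_def Let_def H.m_assoc)
  qed simp
  have one_T: "\<one>\<^bsub>F\<^esub> \<in> T" using rep_one[OF V.one_closed] by (auto simp: T_def intro: image_eqI[of _ _ "\<one>\<^bsub>F\<^esub>"])
  \<comment> \<open>The second component of \<open>w\<close> acting on the base point. For
    \<open>w\<close> in \<open>V\<close> the first component is again the identity, so nothing is
    lost.\<close>
  define s where "s w = snd (foldr step w (\<one>\<^bsub>F\<^esub>, \<one>\<^bsub>H\<^esub>))" for w
  have fold_one: "foldr step v (\<one>\<^bsub>F\<^esub>, \<one>\<^bsub>H\<^esub>) = (\<one>\<^bsub>F\<^esub>, s v) \<and> s v \<in> carrier H \<and> \<pi> (s v) = v"
    if v: "v \<in> V" for v
  proof -
    obtain t f where tf: "foldr step v (\<one>\<^bsub>F\<^esub>, \<one>\<^bsub>H\<^esub>) = (t, f)"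
      by (cases "foldr step v (\<one>\<^bsub>F\<^esub>, \<one>\<^bsub>H\<^esub>)")
    then have t: "t \<in> T" and f: "f \<in> carrier H"
      using fold_closed[OF words[OF v], of "(\<one>\<^bsub>F\<^esub>, \<one>\<^bsub>H\<^esub>)"] one_T by auto
    have "t \<otimes>\<^bsub>F\<^esub> \<pi> f = v \<otimes>\<^bsub>F\<^esub> \<one>\<^bsub>F\<^esub>"
      using val_fold[of "(\<one>\<^bsub>F\<^esub>, \<one>\<^bsub>H\<^esub>)", OF _ words[OF v]] one_T tf
      by (simp add: val_def) (simp add: F_def free_group_def)
    then have eq: "t \<otimes>\<^bsub>F\<^esub> \<pi> f = v" using v by simp
    \<comment> \<open>Since \<open>\<pi> f\<close> lies in \<open>V\<close>, \<open>t\<close>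
      represents the coset of \<open>v\<close>, which is trivial.\<close>
    have "t = rep (t \<otimes>\<^bsub>F\<^esub> \<pi> f)" using rep_mult[of t "\<pi> f"] t f T_closed \<pi>_V rep_T by simp
    then have "t = \<one>\<^bsub>F\<^esub>" using eq rep_one v by simp
    then show ?thesis using tf eq f \<pi>.hom_closed[OF f] by (simp add: s_def)
  qed
  have "s \<in> hom (F\<lparr>carrier := V\<rparr>) H"
  proof (rule homI)
    fix u v assume "u \<in> carrier (F\<lparr>carrier := V\<rparr>)" "v \<in> carrier (F\<lparr>carrier := V\<rparr>)"
    then have u: "u \<in> V" and v: "v \<in> V" by auto
    \<comment> \<open>First \<open>v\<close> moves the base point to second component
      \<open>s v\<close>; equivariance then lets this factor pass through the action of
      \<open>u\<close>.\<close>
    have "foldr step (foldr red_cons u v) (\<one>\<^bsub>F\<^esub>, \<one>\<^bsub>H\<^esub>) =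
        foldr step u (foldr step v (\<one>\<^bsub>F\<^esub>, \<one>\<^bsub>H\<^esub>))"
      by (rule foldr_step_mult[of A "T \<times> carrier H" step, OF closed inverse])
        (use words u v one_T in auto)
    also have "\<dots> = foldr step u (\<one>\<^bsub>F\<^esub>, \<one>\<^bsub>H\<^esub> \<otimes>\<^bsub>H\<^esub> s v)" using fold_one v by simp
    also have "\<dots> = (\<one>\<^bsub>F\<^esub>, s u \<otimes>\<^bsub>H\<^esub> s v)"
      using equivariant[OF one_T H.one_closed _ words[OF u]] fold_one u v by simp
    finally show "s (u \<otimes>\<^bsub>F\<lparr>carrier := V\<rparr>\<^esub> v) = s u \<otimes>\<^bsub>H\<^esub> s v"
      by (simp add: s_def F_def free_group_def)
  qed (use fold_one in simp)
  then show thesis using that[of B \<pi> s] B \<pi> fold_one by (simp add: F_def H_def)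
qed

section \<open>Preimages of subgroups under homomorphisms\<close>

lemma (in group_hom) vimage_normal:
  assumes U: "U \<lhd> H"
  shows "{g \<in> carrier G. h g \<in> U} \<lhd> G"
proof -
  interpret U: normal U H by (rule U)
  have "subgroup {g \<in> carrier G. h g \<in> U} G"
    by (rule subgroup.intro) auto
  then show ?thesis
    by (rule G.normal_invI) (auto intro: U.inv_op_closed2)
qed

text \<open>Each coset of the preimage is the preimage of a coset of \<open>U\<close>, so there are
  at most as many of them.\<close>

lemma (in group_hom) vimage_finite_index:
  assumes U: "subgroup U H" and fin: "finite (rcosets\<^bsub>H\<^esub> U)"
  shows "finite (rcosets {g \<in> carrier G. h g \<in> U})"
proof -
  interpret U: subgroup U H by (rule U)
  let ?V = "{g \<in> carrier G. h g \<in> U}"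
  have "?V #> g = {x \<in> carrier G. h x \<in> U #>\<^bsub>H\<^esub> h g}" if g: "g \<in> carrier G" for g
  proof (intro equalityI subsetI)
    fix x assume x: "x \<in> {x \<in> carrier G. h x \<in> U #>\<^bsub>H\<^esub> h g}"
    then obtain u where u: "u \<in> U" "h x = u \<otimes>\<^bsub>H\<^esub> h g" by (auto simp: r_coset_def)
    then have "h (x \<otimes> inv g) = u" using x g by (simp add: H.m_assoc)
    then have "x \<otimes> inv g \<in> ?V" using x g u(1) by simp
    moreover have "x = x \<otimes> inv g \<otimes> g" using x g by (simp add: G.m_assoc)
    ultimately show "x \<in> ?V #> g" unfolding r_coset_def by blast
  qed (use g in \<open>auto simp: r_coset_def\<close>)
  moreover have "U #>\<^bsub>H\<^esub> h g \<in> rcosets\<^bsub>H\<^esub> U" if "g \<in> carrier G" for g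
    using that by (auto simp: RCOSETS_def)
  ultimately have "rcosets ?V \<subseteq> (\<lambda>C. {x \<in> carrier G. h x \<in> C}) ` (rcosets\<^bsub>H\<^esub> U)"
    unfolding RCOSETS_def[of G] by blast
  then show ?thesis using fin finite_surj by blast
qed

theorem theorem6p1:
  fixes A :: "'a set" and Q R :: "'a letter list set"
    and \<Phi> :: "('a letter list \<Rightarrow> 'a letter list) set"
    and U :: "'a letter list set set"
  assumes "invariant_finite_L_presentation A Q \<Phi> R"
    and "U \<lhd> L_group A Q \<Phi> R"
    and "finite (rcosets\<^bsub>L_group A Q \<Phi> R\<^esub> U)"
    and "\<And>\<phi>. \<phi> \<in> \<Phi> \<Longrightarrow> induced_endo (free_group A) (L_kernel A Q \<Phi> R) \<phi> ` U \<subseteq> U"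
  shows "invariantly_finitely_L_presented ((L_group A Q \<Phi> R)\<lparr>carrier := U\<rparr>)"
proof -

  \<comment> \<open>The preimage of \<open>U\<close> in the free group\<close>
  define F where "F = free_group A"
  define K where "K = L_kernel A Q \<Phi> R"
  define G where "G = F Mod K"
  have G_eq: "L_group A Q \<Phi> R = G" by (simp add: L_group_def G_def F_def K_def)
  have pres: "finite_L_presentation A Q \<Phi> R" and \<Phi>K: "\<And>\<phi>. \<phi> \<in> \<Phi> \<Longrightarrow> \<phi> ` K \<subseteq> K"
    using assms(1) by (auto simp: invariant_finite_L_presentation_def K_def)
  have finA: "finite A" and Q: "finite Q" "Q \<subseteq> carrier F" and \<Phi>: "finite \<Phi>" "\<Phi> \<subseteq> hom F F"
    and R: "finite R" "R \<subseteq> carrier F"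
    using pres by (auto simp: finite_L_presentation_def F_def)
  have K: "K \<lhd> F" unfolding K_def F_def by (rule L_kernel_normal[OF pres])
  interpret K: normal K F by (rule K)
  interpret G: group G unfolding G_def by (rule K.factorgroup_is_group)
  have U: "U \<lhd> G" using assms(2) G_eq by simp
  interpret U: normal U G by (rule U)
  interpret q: group_hom F G "\<lambda>g. K #>\<^bsub>F\<^esub> g"
    using K.r_coset_hom_Mod by unfold_locales (simp add: G_def)
  define V where "V = {g \<in> carrier F. K #>\<^bsub>F\<^esub> g \<in> U}"
  have V_normal: "V \<lhd> F" unfolding V_def by (rule q.vimage_normal[OF U])
  interpret V: normal V F by (rule V_normal)
  have V_index: "finite (rcosets\<^bsub>F\<^esub> V)"
    unfolding V_def by (rule q.vimage_finite_index[OF U.subgroup_axioms assms(3)[unfolded G_eq]])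
  have in_K: "k \<in> K \<longleftrightarrow> k \<in> carrier F \<and> K #>\<^bsub>F\<^esub> k = \<one>\<^bsub>G\<^esub>" for k
  proof -
    have "\<one>\<^bsub>G\<^esub> = K" by (simp add: G_def)
    then show ?thesis
      using K.coset_join1[OF _ _ K.subgroup_axioms] K.coset_join2[OF _ K.subgroup_axioms] K.mem_carrier
      by metis
  qed
  have KV: "K \<subseteq> V" using in_K U.one_closed unfolding V_def by force
  have \<Phi>V: "\<phi> v \<in> V" if "\<phi> \<in> \<Phi>" "v \<in> V" for \<phi> v
  proof -
    have v: "v \<in> carrier F" "K #>\<^bsub>F\<^esub> v \<in> U" and \<phi>: "\<phi> \<in> hom F F"
      using that \<Phi>(2) unfolding V_def by blast+
    have "induced_endo F K \<phi> (K #>\<^bsub>F\<^esub> v) \<in> U"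
      using assms(4)[OF that(1), folded F_def K_def] v(2) by blast
    then have "K #>\<^bsub>F\<^esub> \<phi> v \<in> U"
      by (simp only: K.induced_endo_rcos[OF \<phi> \<Phi>K[OF that(1)] v(1)])
    then show ?thesis using hom_in_carrier[OF \<phi> v(1)] unfolding V_def by blast
  qed

  \<comment> \<open>A transversal of \<open>V\<close> and the retraction onto
    \<open>V\<close>\<close>
  obtain rep where rep: "rep \<in> carrier F \<rightarrow> carrier F" "finite (rep ` carrier F)"
      "\<And>g. g \<in> carrier F \<Longrightarrow> inv\<^bsub>F\<^esub> rep g \<otimes>\<^bsub>F\<^esub> g \<in> V"
    by (rule K.finite_index_transversal[OF V.subgroup_axioms V_index]) (rule that, assumption+)
  \<comment> \<open>Representatives are inverted so that every \<open>g\<close> factors as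
    \<open>v\<close> times \<open>t\<close> with the element of \<open>V\<close> on the left:
    conjugation by \<open>g\<close> is then conjugation by \<open>t\<close> followed by one inside
    \<open>V\<close>.\<close>
  define T where "T = (\<lambda>g. inv\<^bsub>F\<^esub> g) ` rep ` carrier F"
  have T: "finite T" "T \<subseteq> carrier F" using rep by (auto simp: T_def)
  have transversal: "\<exists>t\<in>T. \<exists>v\<in>V. g = v \<otimes>\<^bsub>F\<^esub> t" if g: "g \<in> carrier F" for g
  proof -
    let ?t = "inv\<^bsub>F\<^esub> rep (inv\<^bsub>F\<^esub> g)"
    have r: "rep (inv\<^bsub>F\<^esub> g) \<in> carrier F" using rep(1) g by auto
    have "inv\<^bsub>F\<^esub> (?t \<otimes>\<^bsub>F\<^esub> inv\<^bsub>F\<^esub> g) \<in> V" using rep(3)[of "inv\<^bsub>F\<^esub> g"] g by simp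
    moreover have "g = inv\<^bsub>F\<^esub> (?t \<otimes>\<^bsub>F\<^esub> inv\<^bsub>F\<^esub> g) \<otimes>\<^bsub>F\<^esub> ?t"
      using g r by (simp add: K.inv_mult_group K.m_assoc)
    moreover have "?t \<in> T" using g by (auto simp: T_def)
    ultimately show ?thesis by blast
  qed

  obtain B :: "nat set" and \<pi> s where B: "finite B"
    and \<pi>: "\<pi> \<in> hom (free_group B) (F\<lparr>carrier := V\<rparr>)"
    and s: "s \<in> hom (F\<lparr>carrier := V\<rparr>) (free_group B)"
    and \<pi>_s: "\<And>v. v \<in> V \<Longrightarrow> \<pi> (s v) = v"
    using free_group_finite_index_retract[OF finA, of V] V.subgroup_axioms V_index unfolding F_def by blast
  define H where "H = free_group B"
  interpret H: group H unfolding H_def by (rule free_group_group)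
  interpret FV: group "F\<lparr>carrier := V\<rparr>" by (rule V.subgroup_is_group[OF K.is_group])
  have \<pi>_V: "\<pi> w \<in> V" if "w \<in> carrier H" for w using \<pi> that by (auto simp: hom_def H_def)
  have s_H: "s v \<in> carrier H" if "v \<in> V" for v using s that by (auto simp: hom_def H_def)
  interpret \<pi>: group_hom H F \<pi>
    using \<pi> \<pi>_V V.mem_carrier by unfold_locales (auto simp: hom_def H_def)
  interpret s: group_hom "F\<lparr>carrier := V\<rparr>" H s
    using s by unfold_locales (simp add: H_def)
  have s_mult: "s (u \<otimes>\<^bsub>F\<^esub> v) = s u \<otimes>\<^bsub>H\<^esub> s v" if "u \<in> V" "v \<in> V" for u v
    using s.hom_mult that by simp
  have s_inv: "s (inv\<^bsub>F\<^esub> v) = inv\<^bsub>H\<^esub> s v" if "v \<in> V" for v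
    using s.hom_inv[of v] that K.m_inv_consistent[OF V.subgroup_axioms that] by simp

  \<comment> \<open>Lifted endomorphisms and the new presentation\<close>
  define conj where "conj g v = g \<otimes>\<^bsub>F\<^esub> v \<otimes>\<^bsub>F\<^esub> inv\<^bsub>F\<^esub> g" for g v
  have conj_V: "conj g v \<in> V" if "g \<in> carrier F" "v \<in> V" for g v
    using V.inv_op_closed2 that by (simp add: conj_def)
  have conj_K: "conj g k \<in> K" if "g \<in> carrier F" "k \<in> K" for g k
    using K.inv_op_closed2 that by (simp add: conj_def)
  have conj_hom: "conj g \<in> hom F F" if "g \<in> carrier F" for g
    using that by (intro homI) (simp_all add: conj_def K.m_assoc K.inv_mult_cancel)
  have lift_hom: "s \<circ> \<phi> \<circ> \<pi> \<in> hom H H" if "\<phi> \<in> hom F F" "\<And>v. v \<in> V \<Longrightarrow> \<phi> v \<in> V" for \<phi>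
  proof (rule homI)
    fix u v assume "u \<in> carrier H" "v \<in> carrier H"
    then show "(s \<circ> \<phi> \<circ> \<pi>) (u \<otimes>\<^bsub>H\<^esub> v) = (s \<circ> \<phi> \<circ> \<pi>) u \<otimes>\<^bsub>H\<^esub> (s \<circ> \<phi> \<circ> \<pi>) v"
      using that(1) s_mult that(2) \<pi>_V by (simp add: hom_def)
  qed (use that(2) \<pi>_V s_H in simp)

  \<comment> \<open>The first family consists of the displacements of the generators under
    \<open>s \<circ> \<pi>\<close> and accounts for the kernel of \<open>\<pi>\<close>. Fixed
    relators are not iterated, so the lifts of the \<open>T\<close>-conjugates of \<open>Q\<close>
    are listed explicitly.\<close>
  define Q' where "Q' = (\<lambda>i. inv\<^bsub>H\<^esub> free_gen i \<otimes>\<^bsub>H\<^esub> s (\<pi> (free_gen i))) ` B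
    \<union> (\<lambda>(t, r). s (conj t r)) ` (T \<times> Q)"
  \<comment> \<open>A lifted conjugation, applied last to a lifted iterated relator, gives the lift
    of its conjugate; this replaces an explicit list of conjugates for \<open>R\<close>.\<close>
  define \<Phi>' where "\<Phi>' = (\<lambda>\<phi>. s \<circ> \<phi> \<circ> \<pi>) ` (\<Phi> \<union> conj ` T)"
  define R' where "R' = s ` R"
  define M where "M = L_kernel B Q' \<Phi>' R'"
  \<comment> \<open>This is the preimage of \<open>K\<close> under \<open>\<pi>\<close>, written as
    a kernel so that its normality is immediate.\<close>
  define K' where "K' = kernel H G (\<lambda>w. K #>\<^bsub>F\<^esub> \<pi> w)"
  have K'_iff: "w \<in> K' \<longleftrightarrow> w \<in> carrier H \<and> \<pi> w \<in> K" for w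
    unfolding K'_def kernel_def using in_K \<pi>.hom_closed by blast
  have gen: "free_gen i \<in> carrier H" if "i \<in> B" for i
    using free_gen_closed[OF that] by (simp add: H_def)
  have L_relators: "Q \<subseteq> K" "\<And>\<sigma>. \<sigma> \<in> endo_monoid \<Phi> \<Longrightarrow> \<sigma> ` R \<subseteq> K"
    using normal_closure_superset[of "Q \<union> (\<Union>\<sigma>\<in>endo_monoid \<Phi>. \<sigma> ` R)" F]
    by (auto simp: K_def L_kernel_def F_def)
  have RK: "R \<subseteq> K" using L_relators(2)[OF endo_monoid.id] by simp
  \<comment> \<open>Elements of \<Phi> and conjugations are treated alike from here on: only these
    three common properties matter for the lifts.\<close>
  have \<Phi>'_cases: "\<exists>\<phi>\<in>hom F F. \<psi> = s \<circ> \<phi> \<circ> \<pi> \<and> (\<forall>v\<in>V. \<phi> v \<in> V) \<and> \<phi> ` K \<subseteq> K"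
    if \<psi>: "\<psi> \<in> \<Phi>'" for \<psi>
  proof -
    obtain \<phi> where \<phi>: "\<phi> \<in> \<Phi> \<union> conj ` T" "\<psi> = s \<circ> \<phi> \<circ> \<pi>"
      using \<psi> unfolding \<Phi>'_def by (elim imageE)
    from \<phi>(1) have "\<phi> \<in> hom F F \<and> (\<forall>v\<in>V. \<phi> v \<in> V) \<and> \<phi> ` K \<subseteq> K"
    proof
      assume "\<phi> \<in> \<Phi>"
      then show ?thesis using \<Phi>(2) \<Phi>K[of \<phi>] \<Phi>V[of \<phi>] by blast
    next
      assume "\<phi> \<in> conj ` T"
      then obtain t where "\<phi> = conj t" "t \<in> carrier F" using T(2) by blast
      then show ?thesis using conj_hom conj_V conj_K by (simp add: image_subset_iff)
    qed
    with \<phi>(2) show ?thesis by (intro bexI[of _ \<phi>] conjI) simp_all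
  qed
  have \<Phi>'_hom: "\<psi> \<in> hom H H" if \<psi>: "\<psi> \<in> \<Phi>'" for \<psi>
  proof -
    obtain \<phi> where "\<phi> \<in> hom F F" "\<psi> = s \<circ> \<phi> \<circ> \<pi>" "\<And>v. v \<in> V \<Longrightarrow> \<phi> v \<in> V"
      using \<Phi>'_cases[OF \<psi>] by blast
    then show ?thesis using lift_hom[of \<phi>] by simp
  qed
  \<comment> \<open>Applying \<open>\<pi>\<close> to the lift of \<open>\<phi>\<close> at
    \<open>w\<close> gives \<open>\<phi> (\<pi> w)\<close>, and \<open>\<phi>\<close> preserves
    \<open>K\<close>.\<close>
  have \<Phi>'_K': "\<psi> w \<in> K'" if \<psi>: "\<psi> \<in> \<Phi>'" and w: "w \<in> K'" for \<psi> w
  proof -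
    obtain \<phi> where \<phi>: "\<psi> = s \<circ> \<phi> \<circ> \<pi>" "\<phi> ` K \<subseteq> K" using \<Phi>'_cases[OF \<psi>] by blast
    then have K: "\<phi> (\<pi> w) \<in> K" using w K'_iff by blast
    then have "\<phi> (\<pi> w) \<in> V" using KV by blast
    then show ?thesis using K s_H[of "\<phi> (\<pi> w)"] \<pi>_s[of "\<phi> (\<pi> w)"] by (simp add: K'_iff \<phi>(1))
  qed
  have pres': "finite_L_presentation B Q' \<Phi>' R'"
  proof -
    have "inv\<^bsub>H\<^esub> free_gen i \<otimes>\<^bsub>H\<^esub> s (\<pi> (free_gen i)) \<in> carrier H" if "i \<in> B" for i
      using gen[OF that] s_H[OF \<pi>_V[OF gen[OF that]]] by simp
    moreover have "s (conj t r) \<in> carrier H" if "t \<in> T" "r \<in> Q" for t r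
      using s_H conj_V[of t r] that T(2) L_relators(1) KV by blast
    ultimately have "Q' \<subseteq> carrier H" unfolding Q'_def by auto
    moreover have "R' \<subseteq> carrier H" using s_H RK KV unfolding R'_def by blast
    moreover have "finite Q'" "finite \<Phi>'" "finite R'"
      using B T(1) Q(1) \<Phi>(1) R(1) by (simp_all add: Q'_def \<Phi>'_def R'_def)
    ultimately show ?thesis
      using B \<Phi>'_hom unfolding finite_L_presentation_def H_def[symmetric] by blast
  qed
  have M: "M \<lhd> H" unfolding M_def H_def by (rule L_kernel_normal[OF pres'])
  interpret M: normal M H by (rule M)
  have comp_hom: "(\<lambda>w. K #>\<^bsub>F\<^esub> \<pi> w) \<in> hom H G"
    using hom_compose[OF \<pi>.homh q.homh] by (simp add: comp_def)
  interpret comp: group_hom H G "\<lambda>w. K #>\<^bsub>F\<^esub> \<pi> w" by unfold_locales (rule comp_hom)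
  have K'_normal: "K' \<lhd> H" unfolding K'_def by (rule comp.normal_kernel)

  \<comment> \<open>The new kernel lies in the preimage of \<open>K\<close>\<close>
  have "M \<subseteq> K'"
    unfolding M_def L_kernel_def H_def[symmetric]
  proof (rule H.normal_closure_subset[OF K'_normal])
    have s_K': "s k \<in> K'" if "k \<in> K" for k
    proof -
      have "k \<in> V" using KV that by blast
      then show ?thesis using s_H \<pi>_s that by (simp add: K'_iff)
    qed
    \<comment> \<open>Because \<open>\<pi> \<circ> s\<close> is the identity on \<open>V\<close>,
      these elements are even killed by \<open>\<pi>\<close>.\<close>
    have "inv\<^bsub>H\<^esub> free_gen i \<otimes>\<^bsub>H\<^esub> s (\<pi> (free_gen i)) \<in> K'" if "i \<in> B" for i
    proof -
      show ?thesis
        using gen[OF that] s_H[OF \<pi>_V[OF gen[OF that]]] \<pi>_s[OF \<pi>_V[OF gen[OF that]]] by (simp add: K'_iff)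
    qed
    moreover have "s (conj t r) \<in> K'" if "t \<in> T" "r \<in> Q" for t r
      using s_K' conj_K[of t r] that T(2) L_relators(1) by blast
    ultimately have "Q' \<subseteq> K'" unfolding Q'_def by auto
    moreover have "\<sigma> r \<in> K'" if "\<sigma> \<in> endo_monoid \<Phi>'" "r \<in> R'" for \<sigma> r
      using that
    proof (induction arbitrary: r)
      case id
      then show ?case using RK s_K' unfolding R'_def by auto
    next
      case (comp \<phi> \<sigma>)
      then show ?case using \<Phi>'_K'[of \<phi> "\<sigma> r"] by simp
    qed
    ultimately show "Q' \<union> (\<Union>\<sigma>\<in>endo_monoid \<Phi>'. \<sigma> ` R') \<subseteq> K'"
      by (intro Un_least UN_least image_subsetI)
  qed

  \<comment> \<open>The preimage of \<open>K\<close> lies in the new kernel\<close>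
  have relators': "Q' \<union> (\<Union>\<sigma>\<in>endo_monoid \<Phi>'. \<sigma> ` R') \<subseteq> M"
    unfolding M_def L_kernel_def by (rule normal_closure_superset)
  have sK: "s k \<in> M" if "k \<in> K" for k
  proof -
    \<comment> \<open>\<open>M\<close> is not known to be invariant under the lifted conjugations yet, hence the normal core.\<close>
    define N where "N = {k \<in> V. \<forall>g\<in>carrier F. s (conj g k) \<in> M}"
    have conj_conj: "conj g (conj h k) = conj (g \<otimes>\<^bsub>F\<^esub> h) k"
      if "g \<in> carrier F" "h \<in> carrier F" "k \<in> carrier F" for g h k
      using that by (simp add: conj_def K.m_assoc K.inv_mult_group)
    have "subgroup N F"
    proof (rule K.subgroupI)
      show "N \<subseteq> carrier F" by (auto simp: N_def)
      have "\<one>\<^bsub>F\<^esub> \<in> N" using s.hom_one by (simp add: N_def conj_def M.one_closed)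
      then show "N \<noteq> {}" by blast
      show "inv\<^bsub>F\<^esub> k \<in> N" if k: "k \<in> N" for k
      proof -
        have "conj g (inv\<^bsub>F\<^esub> k) = inv\<^bsub>F\<^esub> conj g k" if "g \<in> carrier F" for g
          using that k by (simp add: N_def conj_def K.m_assoc K.inv_mult_group)
        then show ?thesis using k conj_V s_inv by (simp add: N_def)
      qed
      show "k \<otimes>\<^bsub>F\<^esub> l \<in> N" if kl: "k \<in> N" "l \<in> N" for k l
      proof -
        have "conj g (k \<otimes>\<^bsub>F\<^esub> l) = conj g k \<otimes>\<^bsub>F\<^esub> conj g l" if "g \<in> carrier F" for g
          using conj_hom[OF that] kl by (simp add: N_def hom_def)
        then show ?thesis using kl conj_V s_mult by (simp add: N_def)
      qed
    qed
    then have N: "N \<lhd> F"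
    proof (rule K.normal_invI)
      fix x k assume x: "x \<in> carrier F" and k: "k \<in> N"
      then have "conj x k \<in> N" using conj_V conj_conj by (simp add: N_def)
      then show "x \<otimes>\<^bsub>F\<^esub> k \<otimes>\<^bsub>F\<^esub> inv\<^bsub>F\<^esub> x \<in> N" by (simp add: conj_def)
    qed
    \<comment> \<open>Finitely many conjugations suffice as a test: the remaining factor in
      \<open>V\<close> becomes, under \<open>s\<close>, a conjugation inside \<open>H\<close>, which
      preserves \<open>M\<close>.\<close>
    have N_I: "k \<in> N" if k: "k \<in> V" and kt: "\<And>t. t \<in> T \<Longrightarrow> s (conj t k) \<in> M" for k
    proof -
      have "s (conj g k) \<in> M" if g: "g \<in> carrier F" for g
      proof -
        obtain t v where tv: "t \<in> T" "v \<in> V" "g = v \<otimes>\<^bsub>F\<^esub> t" using transversal[OF g] by blast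
        have t: "t \<in> carrier F" using T(2) tv by blast
        have "conj g k = v \<otimes>\<^bsub>F\<^esub> conj t k \<otimes>\<^bsub>F\<^esub> inv\<^bsub>F\<^esub> v"
          using conj_conj[of v t k] tv t k by (simp add: conj_def)
        then have "s (conj g k) = s v \<otimes>\<^bsub>H\<^esub> s (conj t k) \<otimes>\<^bsub>H\<^esub> inv\<^bsub>H\<^esub> s v"
          using s_mult s_inv conj_V[OF t k] tv(2) by simp
        then show ?thesis using M.inv_op_closed2[OF s_H[OF tv(2)] kt[OF tv(1)]] by simp
      qed
      then show ?thesis using k by (simp add: N_def)
    qed
    \<comment> \<open>Lifts compose on the image of \<open>s\<close>, because the inner
      \<open>\<pi> \<circ> s\<close> cancels on \<open>V\<close>. So every iterated endomorphism has
      a lift in the new monoid.\<close>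
    have lift_endo: "\<exists>\<sigma>'\<in>endo_monoid \<Phi>'. \<forall>v\<in>V. \<sigma>' (s v) = s (\<sigma> v) \<and> \<sigma> v \<in> V"
      if "\<sigma> \<in> endo_monoid \<Phi>" for \<sigma>
      using that
    proof induction
      case id
      show ?case by (rule bexI[OF _ endo_monoid.id]) simp
    next
      case (comp \<phi> \<sigma>)
      then obtain \<sigma>' where \<sigma>': "\<sigma>' \<in> endo_monoid \<Phi>'" "\<And>v. v \<in> V \<Longrightarrow> \<sigma>' (s v) = s (\<sigma> v) \<and> \<sigma> v \<in> V"
        by blast
      have "s \<circ> \<phi> \<circ> \<pi> \<in> \<Phi>'" using comp.hyps(1) unfolding \<Phi>'_def by (intro imageI UnI1)
      then have "(s \<circ> \<phi> \<circ> \<pi>) \<circ> \<sigma>' \<in> endo_monoid \<Phi>'" using \<sigma>'(1) by (rule endo_monoid.comp)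
      moreover have "((s \<circ> \<phi> \<circ> \<pi>) \<circ> \<sigma>') (s v) = s ((\<phi> \<circ> \<sigma>) v) \<and> (\<phi> \<circ> \<sigma>) v \<in> V"
        if "v \<in> V" for v
        using \<sigma>'(2)[OF that] \<Phi>V[OF comp.hyps(1), of "\<sigma> v"] \<pi>_s[of "\<sigma> v"] by simp
      ultimately show ?case by (intro bexI[of _ "(s \<circ> \<phi> \<circ> \<pi>) \<circ> \<sigma>'"] ballI)
    qed
    have "Q \<subseteq> N"
    proof
      fix r assume r: "r \<in> Q"
      have "s (conj t r) \<in> M" if "t \<in> T" for t using relators' r that by (auto simp: Q'_def)
      then show "r \<in> N" using N_I r L_relators(1) KV by blast
    qed
    moreover have "\<sigma> r \<in> N" if \<sigma>: "\<sigma> \<in> endo_monoid \<Phi>" and r: "r \<in> R" for \<sigma> r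
    proof (rule N_I)
      obtain \<sigma>' where \<sigma>': "\<sigma>' \<in> endo_monoid \<Phi>'" "\<And>v. v \<in> V \<Longrightarrow> \<sigma>' (s v) = s (\<sigma> v) \<and> \<sigma> v \<in> V"
        using lift_endo[OF \<sigma>] by blast
      have rV: "r \<in> V" using r RK KV by blast
      then show "\<sigma> r \<in> V" using \<sigma>'(2) by blast
      show "s (conj t (\<sigma> r)) \<in> M" if "t \<in> T" for t
      proof -
        \<comment> \<open>Prepending the lifted conjugation to \<open>\<sigma>'\<close> stays in the
          monoid, and the value at \<open>s r\<close> is \<open>s (conj t (\<sigma> r))\<close>, so
          this element is one of the new iterated relators.\<close>
        have "s \<circ> conj t \<circ> \<pi> \<in> \<Phi>'" using that by (auto simp: \<Phi>'_def)
        then have "(s \<circ> conj t \<circ> \<pi>) \<circ> \<sigma>' \<in> endo_monoid \<Phi>'" using \<sigma>'(1) by (rule endo_monoid.comp)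
        moreover have "((s \<circ> conj t \<circ> \<pi>) \<circ> \<sigma>') (s r) \<in> ((s \<circ> conj t \<circ> \<pi>) \<circ> \<sigma>') ` R'"
          using r unfolding R'_def by (intro imageI)
        ultimately have "((s \<circ> conj t \<circ> \<pi>) \<circ> \<sigma>') (s r) \<in> M" using relators' by blast
        then show ?thesis using \<sigma>'(2)[OF rV] \<pi>_s by simp
      qed
    qed
    ultimately have "K \<subseteq> N"
      unfolding K_def L_kernel_def F_def[symmetric] by (intro K.normal_closure_subset[OF N]) auto
    then have "s (conj \<one>\<^bsub>F\<^esub> k) \<in> M" using \<open>k \<in> K\<close> by (auto simp: N_def)
    then show ?thesis using \<open>k \<in> K\<close> by (simp add: conj_def)
  qed
  \<comment> \<open>Write \<open>w\<close> as \<open>s (\<pi> w)\<close> times the inverse of its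
    displacement under \<open>s \<circ> \<pi>\<close>. The first factor is in \<open>M\<close> by
    \<open>sK\<close>, the second because \<open>Q'\<close> contains the displacements of the
    generators.\<close>
  have "K' \<subseteq> M"
  proof
    fix w assume w: "w \<in> K'"
    then have wH: "w \<in> carrier H" and sw: "s (\<pi> w) \<in> M" using K'_iff sK by auto
    have "s \<circ> \<pi> \<in> hom H H" using hom_compose[OF \<pi> s] by (simp add: H_def)
    then have "inv\<^bsub>H\<^esub> w \<otimes>\<^bsub>H\<^esub> (s \<circ> \<pi>) w \<in> M"
      using normal_contains_displacement[of M B "s \<circ> \<pi>" w] M wH relators'
      by (auto simp: H_def Q'_def)
    then have "(s \<circ> \<pi>) w \<otimes>\<^bsub>H\<^esub> inv\<^bsub>H\<^esub> (inv\<^bsub>H\<^esub> w \<otimes>\<^bsub>H\<^esub> (s \<circ> \<pi>) w) \<in> M"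
      using M.m_closed[OF sw M.m_inv_closed] by simp
    moreover have "(s \<circ> \<pi>) w \<otimes>\<^bsub>H\<^esub> inv\<^bsub>H\<^esub> (inv\<^bsub>H\<^esub> w \<otimes>\<^bsub>H\<^esub> (s \<circ> \<pi>) w) = w"
      using wH M.mem_carrier[OF sw] by (simp add: H.inv_mult_group H.inv_mult_cancel)
    ultimately show "w \<in> M" by (simp only:)
  qed
  with \<open>M \<subseteq> K'\<close> have MK': "M = K'" by blast

  \<comment> \<open>Invariance of the new presentation and the isomorphism with
    \<open>U\<close>\<close>
  have "invariant_finite_L_presentation B Q' \<Phi>' R'"
    unfolding invariant_finite_L_presentation_def M_def[symmetric] MK'
    by (intro conjI pres' ballI image_subsetI) (rule \<Phi>'_K')
  moreover have "G\<lparr>carrier := U\<rparr> \<cong> L_group B Q' \<Phi>' R'"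
  proof -
    have \<pi>_U: "K #>\<^bsub>F\<^esub> \<pi> w \<in> U" if "w \<in> carrier H" for w
      using \<pi>_V[OF that] unfolding V_def by blast
    interpret GU: group "G\<lparr>carrier := U\<rparr>" by (rule U.subgroup_is_group[OF G.is_group])
    \<comment> \<open>Restricting the codomain to \<open>U\<close> makes the map onto, with
      \<open>s\<close> providing preimages, and keeps the kernel \<open>K'\<close>; the first
      isomorphism theorem then applies.\<close>
    interpret f: group_hom H "G\<lparr>carrier := U\<rparr>" "\<lambda>w. K #>\<^bsub>F\<^esub> \<pi> w"
      using comp_hom \<pi>_U by unfold_locales (auto simp: hom_def)
    have "u \<in> (\<lambda>w. K #>\<^bsub>F\<^esub> \<pi> w) ` carrier H" if u: "u \<in> U" for u
    proof -
      obtain g where g: "g \<in> carrier F" "u = K #>\<^bsub>F\<^esub> g"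
        using U.mem_carrier[OF u] by (auto simp: G_def FactGroup_def RCOSETS_def)
      then have "g \<in> V" using u unfolding V_def by blast
      then show ?thesis using g \<pi>_s s_H by (intro image_eqI[of _ _ "s g"]) auto
    qed
    then have "(\<lambda>w. K #>\<^bsub>F\<^esub> \<pi> w) ` carrier H = U" using \<pi>_U by blast
    then have "(\<lambda>w. K #>\<^bsub>F\<^esub> \<pi> w) ` carrier H = carrier (G\<lparr>carrier := U\<rparr>)" by simp
    then have "H Mod kernel H (G\<lparr>carrier := U\<rparr>) (\<lambda>w. K #>\<^bsub>F\<^esub> \<pi> w) \<cong> G\<lparr>carrier := U\<rparr>"
      by (rule f.FactGroup_iso)
    moreover
    have one: "\<one>\<^bsub>G\<lparr>carrier := U\<rparr>\<^esub> = \<one>\<^bsub>G\<^esub>" by simp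
    have "kernel H (G\<lparr>carrier := U\<rparr>) (\<lambda>w. K #>\<^bsub>F\<^esub> \<pi> w) = M"
      unfolding MK' K'_def kernel_def by (simp only: one)
    ultimately have "H Mod M \<cong> G\<lparr>carrier := U\<rparr>" by (simp only:)
    then have "G\<lparr>carrier := U\<rparr> \<cong> H Mod M"
      by (rule group.iso_sym[OF M.factorgroup_is_group])
    then show ?thesis by (simp add: L_group_def H_def M_def)
  qed
  moreover have "group (G\<lparr>carrier := U\<rparr>)" by (rule U.subgroup_is_group[OF G.is_group])
  ultimately show ?thesis unfolding G_eq invariantly_finitely_L_presented_def by blast
qed

end
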